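(* Let $d \geq 2$ be an integer, let $c = \frac{a}{b} \in \mathbb{Q}$ be in lowest terms with $b > 0$, let $f(z) = z^d + c$, and suppose that the critical orbit $\{f^n(0) : n \geq 1\}$ is infinite. Suppose that either $d$ is odd, or $d$ is even and $c \notin (-2^{\frac{1}{d-1}}, -1)$. Then $n \notin \mathcal{Z}(f,0)$ for all $n > 2$. Further, $\mathcal{Z}(f,0)$ is empty unless ($d = 2$ and $a + b = \pm 1$) or $c = \pm 1$.
   Context: Here $f^n$ denotes the $n$-th iterate of $f$. For every $n \geq 1$ one has $f^n(0) = \frac{a_n}{b^{d^{n-1}}}$ in lowest terms, for an integer $a_n$ coprime to $b$; this defines the integer sequence $(a_n)_{n\ge 1}$. The Zsigmondy set $\mathcal{Z}(f,0)$ is the set of indices $n \geq 2$ such that $a_n$ has no primitive prime divisor, i.e. such that for every prime $p$ dividing $a_n$ there exists $1 \leq k < n$ with $p \mid a_k$. *)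

theory Defs
  imports Complex_Main "HOL-Computational_Algebra.Primes"
begin

definition orbit_numerator :: "(rat \<Rightarrow> rat) \<Rightarrow> rat \<Rightarrow> nat \<Rightarrow> int" where
  "orbit_numerator f x n = fst (quotient_of ((f ^^ n) x))"

definition zsigmondy_set :: "(rat \<Rightarrow> rat) \<Rightarrow> rat \<Rightarrow> nat set" where
  "zsigmondy_set f x =
     {n. n \<ge> 2 \<and>
         (\<forall>p. prime p \<and> p dvd orbit_numerator f x n \<longrightarrow>
              (\<exists>k. 1 \<le> k \<and> k < n \<and> p dvd orbit_numerator f x k))}"

(* For f z = z ^ d + a / b, the reduced denominator of the n-th iterate at 0 is
   b ^ (d ^ (n - 1)); hence orbit_numerator f 0 is the sequence of integers a_n
   coprime to b with (f ^^ n) 0 = a_n / b ^ (d ^ (n - 1)), and it is the only one. *)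

lemma quotient_of_critical_orbit:
  fixes d n :: nat and a b :: int and f :: "rat \<Rightarrow> rat"
  assumes d: "d \<ge> 2" and b: "b > 0" and cop: "coprime a b"
    and f: "\<And>z. f z = z ^ d + of_int a / of_int b"
    and n: "n \<ge> 1"
  shows "quotient_of ((f ^^ n) 0) = (orbit_numerator f 0 n, b ^ (d ^ (n - 1)))"
proof -
  have ex: "\<exists>m. coprime m b \<and> (f ^^ n) 0 = of_int m / of_int (b ^ (d ^ (n - 1)))"
    using n
  proof (induction n rule: nat_induct_at_least)
    case base
    show ?case using d cop by (intro exI[of _ a]) (simp add: f power_0_left)
  next
    case (Suc n)
    then obtain m where m: "coprime m b" "(f ^^ n) 0 = of_int m / of_int (b ^ (d ^ (n - 1)))"
      by blast
    let ?e = "d ^ n"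
    have e: "?e = d ^ (n - 1) * d" using Suc.hyps by (cases n) simp_all
    have "d \<le> ?e" using d Suc.hyps by (intro self_le_power) auto
    then have "?e = Suc (Suc (?e - 2))" using d by linarith
    then obtain q where q: "?e = Suc (Suc q)" by blast
    let ?m = "m ^ d + b * (a * b ^ q)"
    have "gcd ?m b = gcd (m ^ d) b"
      using gcd_add_mult[of b "a * b ^ q" "m ^ d"] by (simp add: gcd.commute ac_simps)
    also have "\<dots> = 1" using m(1) by simp
    finally have "coprime ?m b" by (simp add: coprime_iff_gcd_eq_1)
    moreover have "(f ^^ Suc n) 0 = of_int ?m / of_int (b ^ ?e)"
    proof -
      have "(f ^^ Suc n) 0 = (of_int m / of_int (b ^ (d ^ (n - 1)))) ^ d + of_int a / of_int b"
        using m(2) by (simp add: f)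
      also have "\<dots> = of_int (m ^ d) / of_int (b ^ ?e) + of_int a / of_int b"
        by (simp only: power_divide of_int_power e power_mult)
      also have "\<dots> = of_int ?m / of_int (b ^ ?e)"
        using b by (simp add: q field_simps)
      finally show ?thesis .
    qed
    ultimately show ?case by (intro exI[of _ ?m]) simp
  qed
  then obtain m where m: "coprime m b" "(f ^^ n) 0 = of_int m / of_int (b ^ (d ^ (n - 1)))"
    by blast
  then have "(f ^^ n) 0 = Rat.Fract m (b ^ (d ^ (n - 1)))"
    by (simp add: Fract_of_int_quotient)
  then have "quotient_of ((f ^^ n) 0) = (m, b ^ (d ^ (n - 1)))"
    using m(1) b by (simp add: quotient_of_Fract normalize_def)
  then show ?thesis by (simp add: orbit_numerator_def)
qed

lemma orbit_numerator_unique: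
  fixes d n :: nat and a b m :: int and f :: "rat \<Rightarrow> rat"
  assumes "d \<ge> 2" "b > 0" "coprime a b" "\<And>z. f z = z ^ d + of_int a / of_int b" "n \<ge> 1"
  shows "coprime m b \<and> (f ^^ n) 0 = of_int m / of_int (b ^ (d ^ (n - 1)))
           \<longleftrightarrow> m = orbit_numerator f 0 n"
proof -
  note q = quotient_of_critical_orbit[OF assms]
  have e: "d ^ (n - 1) > 0" using assms(1) by simp
  have 1: "coprime (orbit_numerator f 0 n) b"
    using quotient_of_coprime[OF q] assms(1) by auto
  have 2: "(f ^^ n) 0 = of_int (orbit_numerator f 0 n) / of_int (b ^ (d ^ (n - 1)))"
    using quotient_of_div[OF q] .
  show ?thesis using 1 2 assms(2) by auto
qed

end

theory Submission
  imports Defs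
begin

text \<open>
  Write \<open>f\<^sup>n(0) = a\<^sub>n / b ^ (d ^ (n - 1))\<close>. Every \<open>a\<^sub>n\<close> is a multiple of \<open>a\<close>
  (\<open>orbit_numerator_eq_cofactor\<close>); the cofactors
  \<open>B\<^sub>n = a\<^sub>n / a\<close> satisfy \<open>B\<^sub>1 = 1\<close> and \<open>B\<^sub>n\<^sub>+\<^sub>1 = s B\<^sub>n ^ d + b ^ (d ^ n - 1)\<close> with
  \<open>s = a ^ (d - 1)\<close>, and they are coprime to \<open>a\<close> and \<open>b\<close>. Passing from \<open>a\<^sub>n\<close> to \<open>B\<^sub>n\<close> removes the
  primes that divide the whole sequence, and it leaves only the sign and size of \<open>s\<close> to be
  distinguished: for odd \<open>d\<close> the sign of \<open>c\<close> disappears.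

  Arithmetic. The sequence is rigid: because the critical point \<open>0\<close> has multiplicity \<open>d \<ge> 2\<close>,
  modulo \<open>B\<^sub>k\<^sup>2\<close> the orbit is periodic of period \<open>k\<close> from index \<open>1\<close> on
  (\<open>cofactor_shift\<close>). So if \<open>p\<close> first divides the sequence at index \<open>k\<close>, then no later term is
  divisible by a higher power of \<open>p\<close> (\<open>multiplicity_cofactor_le\<close>). If
  \<open>B\<^sub>n\<close> has no primitive prime divisor, all its prime powers therefore already occur earlier, and
  \<open>B\<^sub>n\<close> divides \<open>B\<^sub>1 \<dots> B\<^sub>n\<^sub>-\<^sub>1\<close> (\<open>cofactor_dvd_prod_earlier\<close>).

  Growth. It remains to see that \<open>B\<^sub>n\<close> is larger in absolute value than that product. The
  hypotheses leave three cases (\<open>multiplier_trichotomy\<close>). If \<open>s > 0\<close>, or if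
  \<open>s < - 2 b ^ (d - 1)\<close>, where the critical orbit escapes, then \<open>B\<^sub>n\<^sup>2 < \<bar>B\<^sub>n\<^sub>+\<^sub>1\<bar>\<close>, and induction gives
  the claim for every \<open>n \<ge> 2\<close>. If \<open>- b ^ (d - 1) < s < 0\<close>, which is the case of even \<open>d\<close> and
  \<open>-1 < c < 0\<close>, the orbit stays in \<open>[c, 0)\<close>; for \<open>n \<ge> 2\<close> this pins \<open>B\<^sub>n\<close> between \<open>b ^ (d ^ (n - 1) - d)\<close> and
  \<open>b ^ (d ^ (n - 1) - 1)\<close>, and comparing exponents gives the claim for \<open>n \<ge> 3\<close>. For \<open>n = 2\<close> it only
  fails if \<open>B\<^sub>2 = b ^ (d - 1) - \<bar>a\<bar> ^ (d - 1)\<close> is \<open>1\<close>, that is, for \<open>d = 2\<close> and \<open>a + b = 1\<close>.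
\<close>

section \<open>The reduced sequence of numerators\<close>

text \<open>
  For \<open>s = a ^ (d - 1)\<close> this is \<open>a\<^sub>n / a\<close>. The value at index \<open>0\<close> reflects \<open>f\<^sup>0(0) = 0\<close> and makes the
  recurrence produce \<open>1\<close> at index \<open>1\<close>. The multiplier \<open>s\<close> is a separate parameter because only
  its sign and size, and not \<open>a\<close> itself, govern the sequence.
\<close>

primrec cofactor :: "nat \<Rightarrow> int \<Rightarrow> int \<Rightarrow> nat \<Rightarrow> int" where
  "cofactor d s b 0 = 0"
| "cofactor d s b (Suc n) = s * cofactor d s b n ^ d + b ^ (d ^ n - 1)"

lemma cofactor_one: "d \<ge> 2 \<Longrightarrow> cofactor d s b (Suc 0) = 1"
  by (simp add: power_0_left)

lemma cofactor_two: "d \<ge> 2 \<Longrightarrow> cofactor d s b (Suc (Suc 0)) = s + b ^ (d - 1)"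
  by (simp add: power_0_left)

lemma coprime_cofactor_denominator:
  assumes "d \<ge> 2" "coprime s b" "n \<ge> 1"
  shows "coprime (cofactor d s b n) b"
  using assms(3)
proof (induction n rule: nat_induct_at_least)
  case base
  then show ?case using assms(1) by (simp add: power_0_left)
next
  case (Suc n)
  have "d ^ n \<ge> d" using assms(1) Suc.hyps by (intro self_le_power) auto
  then have "d ^ n - 1 = Suc (d ^ n - 2)" using assms(1) by linarith
  then have "cofactor d s b (Suc n) = b * b ^ (d ^ n - 2) + s * cofactor d s b n ^ d"
    by simp
  moreover have "coprime (s * cofactor d s b n ^ d) b" using Suc.IH assms(2) by simp
  ultimately show ?case
    by (metis coprime_iff_gcd_eq_1 gcd.commute gcd_add_mult mult.commute)
qed

lemma coprime_cofactor_multiplier: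
  assumes "coprime s b"
  shows "coprime (cofactor d s b (Suc n)) s"
proof -
  have "coprime (b ^ (d ^ n - 1)) s" using assms by (simp add: coprime_commute)
  moreover have "gcd (cofactor d s b (Suc n)) s = gcd (b ^ (d ^ n - 1)) s"
    using gcd_add_mult[of s "cofactor d s b n ^ d" "b ^ (d ^ n - 1)"]
    by (simp add: gcd.commute mult.commute)
  ultimately show ?thesis by (simp add: coprime_iff_gcd_eq_1)
qed

lemma orbit_numerator_eq_cofactor:
  fixes d n :: nat and a b :: int and f :: "rat \<Rightarrow> rat"
  assumes d: "d \<ge> 2" and b: "b > 0" and cop: "coprime a b"
    and f: "\<And>z. f z = z ^ d + of_int a / of_int b" and n: "n \<ge> 1"
  shows "orbit_numerator f 0 n = a * cofactor d (a ^ (d - 1)) b n"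
proof -
  let ?B = "cofactor d (a ^ (d - 1)) b"
  have orbit: "(f ^^ Suc m) 0 = of_int (a * ?B (Suc m)) / of_int (b ^ (d ^ m))" for m
  proof (induction m)
    case 0
    show ?case using d by (simp add: f power_0_left)
  next
    case (Suc m)
    have bpow: "b ^ (d ^ Suc m) = b * b ^ (d ^ Suc m - 1)"
      using d by (metis One_nat_def Suc_pred power_Suc zero_less_power pos2 less_le_trans)
    have apow: "a ^ d = a * a ^ (d - 1)"
      using d by (metis Suc_pred' power_Suc pos2 less_le_trans)
    have "(f ^^ Suc (Suc m)) 0 = f ((f ^^ Suc m) 0)" by simp
    also have "\<dots> = (of_int (a * ?B (Suc m)) / of_int (b ^ (d ^ m))) ^ d + of_int a / of_int b"
      by (simp only: f Suc.IH)
    also have "\<dots> = of_int ((a * ?B (Suc m)) ^ d) / of_int (b ^ (d ^ Suc m)) + of_int a / of_int b"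
      by (simp add: power_divide flip: power_mult mult.commute)
    also have "\<dots> = of_int ((a * ?B (Suc m)) ^ d + a * b ^ (d ^ Suc m - 1)) / of_int (b ^ (d ^ Suc m))"
      unfolding bpow using b by (simp add: field_simps)
    also have "(a * ?B (Suc m)) ^ d + a * b ^ (d ^ Suc m - 1) = a * ?B (Suc (Suc m))"
      by (simp only: cofactor.simps(2)[of _ _ _ "Suc m"] power_mult_distrib apow)
        (simp only: distrib_left mult.assoc)
    finally show ?case .
  qed
  have "coprime (a * ?B n) b"
    using coprime_cofactor_denominator[OF d _ n] cop by simp
  moreover have "(f ^^ n) 0 = of_int (a * ?B n) / of_int (b ^ (d ^ (n - 1)))"
    using orbit[of "n - 1"] n by simp
  ultimately show ?thesis
    using orbit_numerator_unique[OF d b cop f n, of "a * ?B n"] by metis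
qed

section \<open>Rigid divisibility\<close>

text \<open>
  This is periodicity of the orbit modulo the square of its \<open>k\<close>-th term: the step from index \<open>k\<close> to
  \<open>k + 1\<close> raises that term to a power of at least \<open>2\<close>, so the orbit restarts there as it did at
  \<open>0\<close>, and the recurrence preserves the congruence. The power of \<open>b\<close> compensates for the different
  denominators.
\<close>

lemma cofactor_shift:
  assumes "d \<ge> 2"
  shows "(cofactor d s b k)\<^sup>2 dvd
           cofactor d s b (k + Suc i) - cofactor d s b (Suc i) * b ^ (d ^ (k + i) - d ^ i)"
proof (induction i)
  case 0
  have "cofactor d s b (k + Suc 0) - cofactor d s b (Suc 0) * b ^ (d ^ (k + 0) - d ^ 0)
      = s * cofactor d s b k ^ d"
    using assms by (simp add: power_0_left)
  then show ?case using assms by (simp only:) (intro dvd_mult le_imp_power_dvd)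
next
  case (Suc i)
  let ?B = "cofactor d s b"
  let ?e = "d ^ (k + i) - d ^ i"
  have pow: "(b ^ ?e) ^ d = b ^ (d ^ (k + Suc i) - d ^ Suc i)"
    by (simp add: diff_mult_distrib diff_mult_distrib2 mult.commute flip: power_mult)
  have split: "b ^ (d ^ (k + Suc i) - 1)
      = b ^ (d ^ Suc i - 1) * b ^ (d ^ (k + Suc i) - d ^ Suc i)"
  proof -
    have "d ^ Suc i \<le> d ^ (k + Suc i)" using assms by (intro power_increasing) auto
    moreover have "1 \<le> d ^ Suc i" using assms by simp
    ultimately show ?thesis by (simp flip: power_add)
  qed
  have "?B (k + Suc (Suc i)) - ?B (Suc (Suc i)) * b ^ (d ^ (k + Suc i) - d ^ Suc i)
      = s * (?B (k + Suc i) ^ d - (?B (Suc i) * b ^ ?e) ^ d)"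
    unfolding add_Suc_right cofactor.simps(2)[of _ _ _ "Suc (k + i)"]
      cofactor.simps(2)[of _ _ _ "Suc i"] power_mult_distrib pow
    using split by (simp only: add_Suc_right) (simp only: algebra_simps)
  moreover have "(?B (k + Suc i) - ?B (Suc i) * b ^ ?e) dvd
      (?B (k + Suc i) ^ d - (?B (Suc i) * b ^ ?e) ^ d)"
    by (subst power_diff_sumr2) (rule dvd_triv_left)
  ultimately show ?case using Suc.IH by (simp only:) (rule dvd_mult, rule dvd_trans)
qed

text \<open>
  Let \<open>e\<close> be the multiplicity at the first index \<open>k\<close>. Since \<open>e \<ge> 1\<close>, the square of the \<open>k\<close>-th term is
  divisible by \<open>p ^ (e + 1)\<close>, so divisibility by \<open>p ^ (e + 1)\<close> descends along \<open>n \<mapsto> n - k\<close> until it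
  contradicts the choice of \<open>k\<close> or of \<open>e\<close>.
\<close>

lemma multiplicity_cofactor_le:
  fixes p :: int
  assumes d: "d \<ge> 2" and cop: "coprime s b" and nz: "\<And>j. j \<ge> 1 \<Longrightarrow> cofactor d s b j \<noteq> 0"
    and p: "prime p" and k: "k \<ge> 1" "p dvd cofactor d s b k"
    and first: "\<And>j. 1 \<le> j \<Longrightarrow> j < k \<Longrightarrow> \<not> p dvd cofactor d s b j"
    and n: "n \<ge> 1"
  shows "multiplicity p (cofactor d s b n) \<le> multiplicity p (cofactor d s b k)"
proof -
  let ?B = "cofactor d s b"
  define e where "e = multiplicity p (?B k)"
  have unit: "\<not> is_unit p" using p by auto
  have "p ^ 1 dvd ?B k" using k(2) by simp
  then have e1: "1 \<le> e"
    unfolding e_def using power_dvd_iff_le_multiplicity[where p = p and n = 1 and x = "?B k"] nz k(1) unit by auto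
  have "p ^ Suc e dvd p ^ (e * 2)" using e1 by (intro le_imp_power_dvd) simp
  also have "\<dots> dvd (?B k)\<^sup>2"
    unfolding e_def power_mult by (intro dvd_power_same multiplicity_dvd)
  finally have sq: "p ^ Suc e dvd (?B k)\<^sup>2" .
  have "coprime p b"
    using coprime_divisors[OF k(2) dvd_refl coprime_cofactor_denominator[OF d cop k(1)]] .
  have "\<not> p ^ Suc e dvd ?B n"
    using n
  proof (induction n rule: less_induct)
    case (less n)
    consider "n < k" | "n = k" | "k < n" by linarith
    then show ?case
    proof cases
      case 1
      then show ?thesis using first less.prems dvd_power_le
        by (metis dvd_mult_left power_Suc)
    next
      case 2
      then show ?thesis
        unfolding e_def using power_dvd_iff_le_multiplicity[where p = p and n = "Suc e" and x = "?B k"] nz k(1) unit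
        by (simp add: e_def)
    next
      case 3
      then obtain i where i: "n = k + Suc i" by (metis less_iff_Suc_add add_Suc_right)
      show ?thesis
      proof
        assume "p ^ Suc e dvd ?B n"
        moreover have "p ^ Suc e dvd ?B n - ?B (Suc i) * b ^ (d ^ (k + i) - d ^ i)"
          unfolding i by (rule dvd_trans[OF sq cofactor_shift[OF d]])
        ultimately have "p ^ Suc e dvd ?B (Suc i) * b ^ (d ^ (k + i) - d ^ i)"
          by (metis dvd_diff_right_iff)
        moreover have "coprime (p ^ Suc e) (b ^ (d ^ (k + i) - d ^ i))"
          using \<open>coprime p b\<close> by simp
        ultimately have "p ^ Suc e dvd ?B (Suc i)"
          using coprime_dvd_mult_left_iff by blast
        then show False using less.IH[of "Suc i"] i k(1) by simp
      qed
    qed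
  qed
  then show ?thesis
    using power_dvd_iff_le_multiplicity[where p = p and n = "Suc e" and x = "?B n"] nz[OF n] unit
    by (simp add: e_def not_less_eq_eq)
qed

lemma cofactor_dvd_prod_earlier:
  assumes d: "d \<ge> 2" and cop: "coprime s b" and nz: "\<And>j. j \<ge> 1 \<Longrightarrow> cofactor d s b j \<noteq> 0"
    and n: "n \<ge> 1"
    and old: "\<And>p. prime p \<Longrightarrow> p dvd cofactor d s b n \<Longrightarrow> \<exists>k. 1 \<le> k \<and> k < n \<and> p dvd cofactor d s b k"
  shows "cofactor d s b n dvd (\<Prod>k=1..<n. cofactor d s b k)"
proof (rule multiplicity_le_imp_dvd)
  let ?B = "cofactor d s b"
  show "?B n \<noteq> 0" using nz n by simp
  fix p :: int assume p: "prime p"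
  show "multiplicity p (?B n) \<le> multiplicity p (\<Prod>k=1..<n. ?B k)"
  proof (cases "p dvd ?B n")
    case False
    then show ?thesis by (simp add: not_dvd_imp_multiplicity_0)
  next
    case True
    define k where "k = (LEAST k. 1 \<le> k \<and> p dvd ?B k)"
    obtain m where m: "1 \<le> m" "m < n" "p dvd ?B m" using old[OF p True] by blast
    have k: "1 \<le> k" "p dvd ?B k" and "k \<le> m"
      unfolding k_def using LeastI[of "\<lambda>k. 1 \<le> k \<and> p dvd ?B k" m] m
      by (auto intro: Least_le)
    have first: "\<not> p dvd ?B j" if "1 \<le> j" "j < k" for j
      using not_less_Least[of j "\<lambda>k. 1 \<le> k \<and> p dvd ?B k"] that unfolding k_def by blast
    have "multiplicity p (?B n) \<le> multiplicity p (?B k)"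
      by (rule multiplicity_cofactor_le[OF d cop nz p k first n])
    also have "\<dots> \<le> multiplicity p (\<Prod>k=1..<n. ?B k)"
      using k(1) \<open>k \<le> m\<close> m(2) nz by (intro dvd_imp_multiplicity_le dvd_prodI) auto
    finally show ?thesis .
  qed
qed

text \<open>
  This reduces the absence of \<open>n\<close> from the Zsigmondy set to an inequality. A prime divisor of the
  cofactor is coprime to \<open>a\<close>, so an earlier numerator that it divides yields an earlier
  cofactor that it divides.
\<close>

lemma not_in_zsigmondy_setI:
  fixes d n :: nat and a b :: int and f :: "rat \<Rightarrow> rat"
  assumes d: "d \<ge> 2" and b: "b > 0" and cop: "coprime a b"
    and f: "\<And>z. f z = z ^ d + of_int a / of_int b"
    and nz: "\<And>j. j \<ge> 1 \<Longrightarrow> cofactor d (a ^ (d - 1)) b j \<noteq> 0"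
    and big: "(\<Prod>k=1..<n. \<bar>cofactor d (a ^ (d - 1)) b k\<bar>) < \<bar>cofactor d (a ^ (d - 1)) b n\<bar>"
  shows "n \<notin> zsigmondy_set f 0"
proof
  let ?s = "a ^ (d - 1)"
  let ?B = "cofactor d ?s b"
  assume Z: "n \<in> zsigmondy_set f 0"
  then have n: "n \<ge> 1" by (simp add: zsigmondy_set_def)
  have cops: "coprime ?s b" using cop by simp
  have num: "orbit_numerator f 0 k = a * ?B k" if "k \<ge> 1" for k
    using orbit_numerator_eq_cofactor[OF d b cop f that] .
  have "?B n dvd (\<Prod>k=1..<n. ?B k)"
  proof (rule cofactor_dvd_prod_earlier[OF d cops nz n])
    fix p :: int assume p: "prime p" "p dvd ?B n"
    then have "p dvd orbit_numerator f 0 n" using num[OF n] by simp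
    then obtain k where k: "1 \<le> k" "k < n" "p dvd orbit_numerator f 0 k"
      using Z p(1) unfolding zsigmondy_set_def by blast
    then have dvd: "p dvd a * ?B k" using num by simp
    have "coprime (?B n) ?s"
      using coprime_cofactor_multiplier[OF cops, of d "n - 1"] n by simp
    then have "coprime (?B n) a" using d by simp
    then have "\<not> p dvd a" using p coprime_common_divisor not_prime_unit by blast
    then show "\<exists>k. 1 \<le> k \<and> k < n \<and> p dvd ?B k"
      using k dvd p(1) prime_dvd_mult_iff by blast
  qed
  then have "\<bar>?B n\<bar> \<le> \<bar>\<Prod>k=1..<n. ?B k\<bar>"
    using nz by (intro dvd_imp_le_int) auto
  then show False using big by (simp add: abs_prod)
qed

section \<open>Growth\<close>

lemma prod_less_of_square_less:
  fixes B :: "nat \<Rightarrow> int"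
  assumes one: "B 1 = 1" and sq: "\<And>n. n \<ge> 1 \<Longrightarrow> \<bar>B n\<bar>\<^sup>2 < \<bar>B (Suc n)\<bar>" and n: "n \<ge> 2"
  shows "(\<Prod>k=1..<n. \<bar>B k\<bar>) < \<bar>B n\<bar>"
proof -
  have step: "(\<Prod>k=1..<Suc m. \<bar>B k\<bar>) < \<bar>B (Suc m)\<bar>"
    if "m \<ge> 1" "(\<Prod>k=1..<m. \<bar>B k\<bar>) \<le> \<bar>B m\<bar>" for m
  proof -
    have "(\<Prod>k=1..<Suc m. \<bar>B k\<bar>) = (\<Prod>k=1..<m. \<bar>B k\<bar>) * \<bar>B m\<bar>" using that(1) by simp
    also have "\<dots> \<le> \<bar>B m\<bar> * \<bar>B m\<bar>" using that(2) by (intro mult_right_mono) auto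
    also have "\<dots> < \<bar>B (Suc m)\<bar>" using sq[OF that(1)] by (simp add: power2_eq_square)
    finally show ?thesis .
  qed
  have "(\<Prod>k=1..<m. \<bar>B k\<bar>) \<le> \<bar>B m\<bar>" if "m \<ge> 1" for m
    using that
  proof (induction m rule: nat_induct_at_least)
    case base
    show ?case using one by simp
  next
    case (Suc m)
    show ?case using step[OF Suc] by simp
  qed
  then show ?thesis using step[of "n - 1"] n by simp
qed

lemma nonzero_of_square_less:
  fixes B :: "nat \<Rightarrow> int"
  assumes one: "B 1 = 1" and sq: "\<And>n. n \<ge> 1 \<Longrightarrow> \<bar>B n\<bar>\<^sup>2 < \<bar>B (Suc n)\<bar>" and n: "n \<ge> 1"
  shows "B n \<noteq> 0"
proof (cases "n = 1")
  case False
  then have "\<bar>B (n - 1)\<bar>\<^sup>2 < \<bar>B n\<bar>" using sq[of "n - 1"] n by simp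
  then show ?thesis by (metis abs_zero not_less zero_le_power2)
qed (use one in simp)

lemma square_le_power:
  fixes x :: int
  assumes "x \<ge> 1" "d \<ge> 2"
  shows "x\<^sup>2 \<le> x ^ d"
  using assms by (intro power_increasing) auto

text \<open>
  The number \<open>b ^ (d ^ n - 1)\<close> is the quotient of the denominators of \<open>f\<^sup>n\<^sup>+\<^sup>1(0)\<close> and \<open>f(0)\<close>, and
  therefore the scale on which the cofactors are measured. The identity says how the
  recurrence transports this scale.
\<close>

lemma power_tower_step:
  fixes b :: int
  assumes "d \<ge> 2"
  shows "b ^ (d - 1) * (b ^ (d ^ n - 1)) ^ d = b ^ (d ^ Suc n - 1)"
proof -
  have "d * d ^ n \<ge> d" using assms by simp
  then have "d - 1 + (d ^ n - 1) * d = d ^ Suc n - 1"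
    using assms by (simp add: diff_mult_distrib2 mult.commute)
  moreover have "b ^ (d - 1) * (b ^ (d ^ n - 1)) ^ d = b ^ (d - 1 + (d ^ n - 1) * d)"
    by (simp only: power_add power_mult)
  ultimately show ?thesis by simp
qed

lemma cofactor_square_less_positive:
  assumes d: "d \<ge> 2" and b: "b > 0" and s: "s > 0" and n: "n \<ge> 1"
  shows "\<bar>cofactor d s b n\<bar>\<^sup>2 < \<bar>cofactor d s b (Suc n)\<bar>"
proof -
  let ?B = "cofactor d s b"
  have pos: "?B m \<ge> 1" if "m \<ge> 1" for m
    using that
  proof (induction m rule: nat_induct_at_least)
    case base
    show ?case using d by (simp add: power_0_left)
  next
    case (Suc m)
    have "0 \<le> s * ?B m ^ d" using Suc.IH s by simp
    moreover have "b ^ (d ^ m - 1) > 0" using b by simp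
    ultimately show ?case by simp
  qed
  have "(?B n)\<^sup>2 \<le> ?B n ^ d" using square_le_power[OF pos[OF n] d] .
  also have "\<dots> \<le> s * ?B n ^ d" using s pos[OF n] by simp
  also have "\<dots> < ?B (Suc n)" using b by simp
  finally show ?thesis using pos[of "Suc n"] by simp
qed

text \<open>
  Here \<open>\<bar>f\<^sup>m(0)\<bar> \<ge> \<bar>c\<bar>\<close> for all \<open>m \<ge> 1\<close>, which in terms of cofactors is the lower bound
  \<open>b ^ (d ^ (m - 1) - 1)\<close>. It makes the inhomogeneous term of the recurrence at most
  \<open>b ^ (d - 1)\<close> times the \<open>d\<close>-th power of the cofactor, hence less than half of the
  leading term.
\<close>

lemma cofactor_square_less_escaping:
  assumes d: "d \<ge> 2" and b: "b > 0" and s: "s < - 2 * b ^ (d - 1)" and n: "n \<ge> 1"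
  shows "\<bar>cofactor d s b n\<bar>\<^sup>2 < \<bar>cofactor d s b (Suc n)\<bar>"
proof -
  let ?B = "cofactor d s b"
  have bpos: "b ^ (d - 1) \<ge> 1" using b by simp
  have step: "(b ^ (d - 1) + 1) * \<bar>?B m\<bar> ^ d \<le> \<bar>?B (Suc m)\<bar>"
    if "b ^ (d ^ (m - 1) - 1) \<le> \<bar>?B m\<bar>" "m \<ge> 1" for m
  proof -
    have "b ^ (d ^ m - 1) = b ^ (d - 1) * (b ^ (d ^ (m - 1) - 1)) ^ d"
      using power_tower_step[OF d, of b "m - 1"] that(2) by simp
    also have "\<dots> \<le> b ^ (d - 1) * \<bar>?B m\<bar> ^ d"
      using that(1) b by (intro mult_left_mono power_mono) auto
    finally have tail: "b ^ (d ^ m - 1) \<le> b ^ (d - 1) * \<bar>?B m\<bar> ^ d" .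
    have "(2 * b ^ (d - 1) + 1) * \<bar>?B m\<bar> ^ d \<le> \<bar>s\<bar> * \<bar>?B m\<bar> ^ d"
      using s by (intro mult_right_mono) auto
    also have "\<dots> = \<bar>s * ?B m ^ d\<bar>" by (simp add: abs_mult power_abs)
    also have "\<dots> = \<bar>?B (Suc m) - b ^ (d ^ m - 1)\<bar>" by simp
    also have "\<dots> \<le> \<bar>?B (Suc m)\<bar> + \<bar>b ^ (d ^ m - 1)\<bar>" by (rule abs_triangle_ineq4)
    also have "\<bar>b ^ (d ^ m - 1)\<bar> = b ^ (d ^ m - 1)" using b by simp
    finally show ?thesis using tail by (simp add: algebra_simps)
  qed
  have low: "b ^ (d ^ (m - 1) - 1) \<le> \<bar>?B m\<bar>" if "m \<ge> 1" for m
    using that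
  proof (induction m rule: nat_induct_at_least)
    case base
    show ?case using d by (simp add: power_0_left)
  next
    case (Suc m)
    have "b ^ (d ^ m - 1) = b ^ (d - 1) * (b ^ (d ^ (m - 1) - 1)) ^ d"
      using power_tower_step[OF d, of b "m - 1"] Suc.hyps by simp
    also have "\<dots> \<le> (b ^ (d - 1) + 1) * \<bar>?B m\<bar> ^ d"
      using Suc.IH b by (intro mult_mono power_mono) auto
    also have "\<dots> \<le> \<bar>?B (Suc m)\<bar>" by (rule step[OF Suc.IH Suc.hyps])
    finally show ?case by simp
  qed
  have "1 \<le> b ^ (d ^ (n - 1) - 1)" using b by simp
  then have ge1: "1 \<le> \<bar>?B n\<bar>" using low[OF n] by linarith
  have "\<bar>?B n\<bar>\<^sup>2 \<le> \<bar>?B n\<bar> ^ d" using square_le_power[OF ge1 d] .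
  also have "\<dots> < 2 * \<bar>?B n\<bar> ^ d" using ge1 by simp
  also have "\<dots> \<le> (b ^ (d - 1) + 1) * \<bar>?B n\<bar> ^ d"
    using bpos by (intro mult_right_mono) auto
  also have "\<dots> \<le> \<bar>?B (Suc n)\<bar>" by (rule step[OF low[OF n] n])
  finally show ?thesis .
qed

text \<open>
  For \<open>s = a ^ (d - 1)\<close> with \<open>a < 0\<close> and even \<open>d\<close>, this reflects that \<open>f\<close> maps \<open>[c, 0)\<close> into
  \<open>[c, c + \<bar>c\<bar> ^ d]\<close>, an interval of negative numbers. The distance of its right end from \<open>0\<close>
  is controlled by \<open>b ^ (d - 1) + s\<close>, which is positive and an integer, hence at least \<open>1\<close>; this
  gives the lower bound.
\<close>

lemma cofactor_bounds_trapped: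
  assumes d: "d \<ge> 2" and b: "b > 0" and s: "- (b ^ (d - 1)) < s" "s < 0"
  shows "0 < cofactor d s b (Suc n)" "cofactor d s b (Suc n) \<le> b ^ (d ^ n - 1)"
    and "b ^ (d ^ Suc n - d) \<le> cofactor d s b (Suc (Suc n))"
proof -
  let ?B = "cofactor d s b"
  have step: "b ^ (d ^ Suc m - d) \<le> ?B (Suc (Suc m)) \<and> ?B (Suc (Suc m)) \<le> b ^ (d ^ Suc m - 1)"
    if "0 < ?B (Suc m)" "?B (Suc m) \<le> b ^ (d ^ m - 1)" for m
  proof
    have exp: "(b ^ (d ^ m - 1)) ^ d = b ^ (d ^ Suc m - d)"
      unfolding power_mult[symmetric] by (simp add: diff_mult_distrib2 mult.commute)
    have pow: "?B (Suc m) ^ d \<le> b ^ (d ^ Suc m - d)"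
      unfolding exp[symmetric] using that by (intro power_mono) auto
    have "b ^ (d ^ Suc m - d) \<le> (b ^ (d - 1) + s) * b ^ (d ^ Suc m - d)"
      using s b by simp
    also have "\<dots> = b ^ (d ^ Suc m - 1) + s * b ^ (d ^ Suc m - d)"
      using power_tower_step[OF d, of b m] unfolding exp by (simp add: distrib_right)
    also have "\<dots> \<le> b ^ (d ^ Suc m - 1) + s * ?B (Suc m) ^ d"
      using pow s(2) by (intro add_left_mono mult_left_mono_neg) auto
    finally show "b ^ (d ^ Suc m - d) \<le> ?B (Suc (Suc m))"
      by (simp only: cofactor.simps(2)[of _ _ _ "Suc m"] add.commute)
    have "s * ?B (Suc m) ^ d \<le> 0"
      using s(2) that(1) by (intro mult_nonpos_nonneg) auto
    then show "?B (Suc (Suc m)) \<le> b ^ (d ^ Suc m - 1)"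
      by (simp only: cofactor.simps(2)[of _ _ _ "Suc m"])
  qed
  have inv: "0 < ?B (Suc m) \<and> ?B (Suc m) \<le> b ^ (d ^ m - 1)" for m
  proof (induction m)
    case 0
    show ?case using d by (simp add: power_0_left)
  next
    case (Suc m)
    moreover have "0 < b ^ (d ^ Suc m - d)" using b by simp
    ultimately show ?case using step[of m] by linarith
  qed
  show "0 < ?B (Suc n)" "?B (Suc n) \<le> b ^ (d ^ n - 1)" using inv by auto
  show "b ^ (d ^ Suc n - d) \<le> ?B (Suc (Suc n))" using step inv by blast
qed

text \<open>
  Summing the exponents of the upper bounds gives at most \<open>d ^ m - d - 1\<close> for the product of the first
  \<open>m\<close> terms, one less than the exponent \<open>d ^ m - d\<close> of the lower bound for the next term. The induction
  closes because \<open>2 d ^ m \<le> d ^ (m + 1)\<close>; it starts at \<open>m = 2\<close>, since for \<open>m = 1\<close> the product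
  and the lower bound are both \<open>1\<close>. This is why the statement begins at \<open>n = 3\<close>.
\<close>

lemma prod_cofactor_less_trapped:
  assumes d: "d \<ge> 2" and b: "b \<ge> 2" and s: "- (b ^ (d - 1)) < s" "s < 0"
    and n: "n \<ge> 3"
  shows "(\<Prod>k=1..<n. \<bar>cofactor d s b k\<bar>) < \<bar>cofactor d s b n\<bar>"
proof -
  let ?B = "cofactor d s b"
  have b0: "b > 0" using b by simp
  note bounds = cofactor_bounds_trapped[OF d b0 s]
  have abs_le: "\<bar>?B (Suc m)\<bar> \<le> b ^ (d ^ m - 1)" for m
    using bounds(1,2)[of m] by simp
  have prod: "(\<Prod>k=1..<Suc m. \<bar>?B k\<bar>) \<le> b ^ (d ^ m - d - 1)" if "m \<ge> 2" for m
    using that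
  proof (induction m rule: nat_induct_at_least)
    case base
    have "(\<Prod>k=1..<Suc 2. \<bar>?B k\<bar>) = \<bar>?B (Suc 1)\<bar>"
      using cofactor_one[OF d, of s b]
      by (simp del: cofactor.simps add: numeral_2_eq_2 prod.atLeastLessThan_Suc)
    also have "\<dots> \<le> b ^ (d - 1)" using abs_le[of 1] by simp
    also have "\<dots> \<le> b ^ (d ^ 2 - d - 1)"
    proof (rule power_increasing)
      have "2 * d \<le> d * d" using d by simp
      then show "d - 1 \<le> d ^ 2 - d - 1" unfolding power2_eq_square by linarith
    qed (use b in simp)
    finally show ?case .
  next
    case (Suc m)
    have "d ^ 2 \<le> d ^ m" using Suc.hyps d by (intro power_increasing) auto
    moreover have "2 * d \<le> d ^ 2" using d by (simp add: power2_eq_square)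
    ultimately have dm: "2 * d \<le> d ^ m" by linarith
    have "2 * d ^ m \<le> d ^ Suc m" using d by simp
    then have exp: "d ^ m - d - 1 + (d ^ m - 1) \<le> d ^ Suc m - d - 1" using dm d by linarith
    have "(\<Prod>k=1..<Suc (Suc m). \<bar>?B k\<bar>) = (\<Prod>k=1..<Suc m. \<bar>?B k\<bar>) * \<bar>?B (Suc m)\<bar>"
      by (simp only: prod.atLeastLessThan_Suc)
    also have "\<dots> \<le> b ^ (d ^ m - d - 1) * b ^ (d ^ m - 1)"
      using Suc.IH abs_le[of m] b by (intro mult_mono) auto
    also have "\<dots> \<le> b ^ (d ^ Suc m - d - 1)"
      unfolding power_add[symmetric] using exp b by (intro power_increasing) auto
    finally show ?case .
  qed
  obtain m where m: "n = Suc (Suc m)" "m \<ge> 1" 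
    using n by (metis Suc_le_D numeral_3_eq_3 One_nat_def Suc_le_mono)
  have "d < d ^ Suc m" using d m(2) power_strict_increasing[of 1 "Suc m" d] by simp
  then have "d ^ Suc m - d = Suc (d ^ Suc m - d - 1)" by linarith
  then have "b ^ (d ^ Suc m - d - 1) < b ^ (d ^ Suc m - d)"
    using b by (intro power_strict_increasing) auto
  moreover have "(\<Prod>k=1..<n. \<bar>?B k\<bar>) \<le> b ^ (d ^ Suc m - d - 1)"
    using prod[of "Suc m"] m by simp
  ultimately show ?thesis using bounds(3)[of m] unfolding m(1) by linarith
qed

text \<open>
  For \<open>d = e + 2\<close> the difference of the powers is at least \<open>(y - x) y ^ e\<close>, and \<open>y \<ge> 2\<close>, so
  only \<open>e = 0\<close> is possible.
\<close>

lemma power_gap_eq_one: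
  fixes x y :: int
  assumes "0 < x" "x < y" "d \<ge> 2" "y ^ (d - 1) - x ^ (d - 1) = 1"
  shows "d = 2 \<and> y = x + 1"
proof -
  obtain e where e: "d = Suc (Suc e)" using assms(3) by (metis Suc_le_D numeral_2_eq_2 Suc_le_mono)
  have "x * x ^ e \<le> x * y ^ e" using assms(1,2) by (intro mult_left_mono power_mono) auto
  moreover have "1 * y ^ e \<le> (y - x) * y ^ e" using assms(1,2) by (intro mult_right_mono) auto
  ultimately have "y ^ e \<le> 1" using assms(4) e by (simp add: left_diff_distrib)
  moreover have "y ^ e > 1" if "e > 0" using assms(1,2) that by (intro one_less_power) auto
  ultimately have "e = 0" by fastforce
  then show ?thesis using e assms(4) by simp
qed

section \<open>Primitive prime divisors\<close>

lemma finite_orbit_if_recurrent: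
  fixes f :: "'a \<Rightarrow> 'a"
  assumes "(f ^^ (i + j)) x = (f ^^ i) x" "j > 0"
  shows "finite {(f ^^ n) x | n. n \<ge> 1}"
proof -
  have "(f ^^ n) x \<in> (\<lambda>m. (f ^^ m) x) ` {..<i + j}" for n
  proof (induction n rule: less_induct)
    case (less n)
    show ?case
    proof (cases "n < i + j")
      case False
      then have "(f ^^ n) x = (f ^^ (n - (i + j))) ((f ^^ (i + j)) x)"
        by (metis funpow_add comp_apply le_add_diff_inverse2 not_less)
      also have "\<dots> = (f ^^ (n - j)) x"
      proof -
        have "n - j = (n - (i + j)) + i" using False by simp
        then show ?thesis using assms(1) by (simp add: funpow_add)
      qed
      finally show ?thesis using less.IH[of "n - j"] False assms(2) by simp
    qed auto
  qed
  then have "{(f ^^ n) x | n. n \<ge> 1} \<subseteq> (\<lambda>m. (f ^^ m) x) ` {..<i + j}" by blast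
  then show ?thesis by (rule finite_subset) simp
qed

text \<open>
  The boundary cases are excluded by the infinite orbit. For \<open>c = 0\<close>, and for \<open>c = -1\<close> with \<open>d\<close> even,
  the point \<open>0\<close> is periodic. If \<open>d\<close> is even and \<open>c ^ (d - 1) = -2\<close>, then \<open>f(c) = c (c ^ (d - 1) + 1) = - c\<close>
  is a fixed point.
\<close>

lemma multiplier_trichotomy:
  fixes d :: nat and a b :: int and c :: rat and f :: "rat \<Rightarrow> rat"
  assumes d: "d \<ge> 2" and b: "b > 0" and c: "c = of_int a / of_int b"
    and f: "\<And>z. f z = z ^ d + c"
    and inf: "infinite {(f ^^ n) 0 | n. n \<ge> 1}"
    and escape: "odd d \<or>
         (even d \<and> real_of_rat c \<notin> {- (2 powr (1 / (real d - 1))) <..< - 1})"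
  obtains
    (positive) "a ^ (d - 1) > 0"
  | (trapped) "- (b ^ (d - 1)) < a ^ (d - 1)" "a ^ (d - 1) < 0" "even d" "0 < - a" "- a < b"
  | (escaping) "a ^ (d - 1) < - 2 * b ^ (d - 1)"
proof -
  have norec: "(f ^^ (i + j)) 0 \<noteq> (f ^^ i) 0" if "j > 0" for i j
    using finite_orbit_if_recurrent[of i j f 0] that inf by blast
  have f0: "f 0 = c" using d by (simp add: f)
  have "c \<noteq> 0" using norec[of 1 0] f0 by simp
  then have a0: "a \<noteq> 0" using c by auto
  show thesis
  proof (cases "a ^ (d - 1) > 0")
    case True
    then show ?thesis by (rule positive)
  next
    case False
    then have neg: "a ^ (d - 1) < 0" using a0 by (metis linorder_neqE power_eq_0_iff)
    \<comment> \<open>An odd power that is negative: this case only arises for even \<open>d\<close> and negative \<open>c\<close>.\<close>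
    then have aneg: "a < 0" and "odd (d - 1)"
      by (auto simp: power_less_zero_eq)
    then have ev: "even d" using d by simp
    have s: "a ^ (d - 1) = - ((- a) ^ (d - 1))" using \<open>odd (d - 1)\<close> by simp
    have rc: "real_of_rat c = - (of_int (- a) / of_int b)"
      unfolding c by (simp add: of_rat_divide)
    have cd: "c ^ d = c * c ^ (d - 1)" using d by (metis Suc_pred' power_Suc pos2 less_le_trans)
    consider "real_of_rat c \<ge> - 1" | "real_of_rat c \<le> - (2 powr (1 / (real d - 1)))"
      using escape ev by fastforce
    then show ?thesis
    proof cases
      case 1
      then have "real_of_int (- a) \<le> real_of_int b" unfolding rc using b by (simp add: field_simps)
      then have le: "- a \<le> b" by linarith
      have "- a \<noteq> b"
      proof
        assume "- a = b"
        then have "c = - 1" using c b by auto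
        then have "(f ^^ 2) 0 = 0" using f0 ev d by (simp add: f numeral_2_eq_2 power_0_left)
        then show False using norec[of 2 0] by (simp add: numeral_2_eq_2)
      qed
      then have lt: "- a < b" using le by simp
      then have "(- a) ^ (d - 1) < b ^ (d - 1)"
        using aneg d by (intro power_strict_mono) auto
      then show ?thesis using trapped neg s ev aneg lt by simp
    next
      case 2
      let ?t = "real_of_int (- a) / real_of_int b"
      have dr: "real d - 1 = real (d - 1)" using d by simp
      have "(2 powr (1 / (real d - 1))) ^ (d - 1) = (2::real)"
        unfolding dr using d by (subst powr_realpow[symmetric]) (simp_all add: powr_powr)
      moreover have "(2 powr (1 / (real d - 1))) ^ (d - 1) \<le> ?t ^ (d - 1)"
        using 2 rc by (intro power_mono) auto
      ultimately have "2 \<le> ?t ^ (d - 1)" by simp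
      then have "2 * real_of_int b ^ (d - 1) \<le> real_of_int (- a) ^ (d - 1)"
        unfolding power_divide using b by (simp add: pos_le_divide_eq)
      then have le: "2 * b ^ (d - 1) \<le> (- a) ^ (d - 1)"
      proof -
        have "real_of_int (2 * b ^ (d - 1)) \<le> real_of_int ((- a) ^ (d - 1))"
          using \<open>2 * real_of_int b ^ (d - 1) \<le> _\<close> by simp
        then show ?thesis by (simp only: of_int_le_iff)
      qed
      have "2 * b ^ (d - 1) \<noteq> (- a) ^ (d - 1)"
      proof
        assume "2 * b ^ (d - 1) = (- a) ^ (d - 1)"
        then have "a ^ (d - 1) = - 2 * b ^ (d - 1)" using s by simp
        then have "of_int (a ^ (d - 1)) = (of_int (- 2 * b ^ (d - 1)) :: rat)"
          by (simp only:)
        then have "of_int a ^ (d - 1) = (- 2 * of_int b ^ (d - 1) :: rat)" by simp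
        then have "c ^ (d - 1) = - 2" using c b by (simp add: power_divide)
        then have f2: "f c = - c" by (simp add: f cd)
        have "f (- c) = - c" using f2 ev by (simp add: f)
        then have "(f ^^ (2 + 1)) 0 = (f ^^ 2) 0" using f0 f2 by (simp add: numeral_2_eq_2)
        then show False using norec[of 1 2] by simp
      qed
      then show ?thesis using escaping le s by simp
    qed
  qed
qed

theorem theorem1p3:
  fixes d :: nat and a b :: int and c :: rat and f :: "rat \<Rightarrow> rat"
  assumes "d \<ge> 2"
    and "b > 0" and "coprime a b" and "c = of_int a / of_int b"
    and "\<And>z. f z = z ^ d + c"
    and "infinite {(f ^^ n) 0 | n. n \<ge> 1}"
    and "odd d \<or>
         (even d \<and> real_of_rat c \<notin> {- (2 powr (1 / (real d - 1))) <..< - 1})"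
  shows "(\<forall>n > 2. n \<notin> zsigmondy_set f 0) \<and>
         (\<not> ((d = 2 \<and> (a + b = 1 \<or> a + b = - 1)) \<or> c = 1 \<or> c = - 1)
            \<longrightarrow> zsigmondy_set f 0 = {})"
proof -
  let ?B = "cofactor d (a ^ (d - 1)) b"
  note d = assms(1) and b = assms(2)
  have f: "f z = z ^ d + of_int a / of_int b" for z using assms(4,5) by simp
  note notin = not_in_zsigmondy_setI[OF d b assms(3) f]
  have Z2: "n \<ge> 2" if "n \<in> zsigmondy_set f 0" for n
    using that by (simp add: zsigmondy_set_def)
  have one: "?B 1 = 1" using d by (simp add: power_0_left)
  have growing: ?thesis if sq: "\<And>n. n \<ge> 1 \<Longrightarrow> \<bar>?B n\<bar>\<^sup>2 < \<bar>?B (Suc n)\<bar>"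
  proof -
    have "n \<notin> zsigmondy_set f 0" if "n \<ge> 2" for n
      using notin nonzero_of_square_less[OF one sq] prod_less_of_square_less[OF one sq that]
      by blast
    then show ?thesis using Z2 by fastforce
  qed
  show ?thesis
  proof (rule multiplier_trichotomy[OF d b assms(4-7)])
    assume "a ^ (d - 1) > 0"
    then show ?thesis by (rule growing[OF cofactor_square_less_positive[OF d b]])
  next
    assume "a ^ (d - 1) < - 2 * b ^ (d - 1)"
    then show ?thesis by (rule growing[OF cofactor_square_less_escaping[OF d b]])
  next
    assume s: "- (b ^ (d - 1)) < a ^ (d - 1)" "a ^ (d - 1) < 0" and ev: "even d"
      and ab: "0 < - a" "- a < b"
    have pos: "?B (Suc n) > 0" for n using cofactor_bounds_trapped(1)[OF d b s] .
    then have nz: "?B n \<noteq> 0" if "n \<ge> 1" for n using that by (metis Suc_le_D One_nat_def less_irrefl)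
    have tail: "n \<notin> zsigmondy_set f 0" if "n > 2" for n
      using notin[OF nz] prod_cofactor_less_trapped[OF d _ s, of n] ab that by simp
    have second: "2 \<notin> zsigmondy_set f 0" if ne: "\<not> (d = 2 \<and> a + b = 1)"
    proof -
      have "odd (d - 1)" using ev d by simp
      then have B2: "?B 2 = b ^ (d - 1) - (- a) ^ (d - 1)"
        using cofactor_two[OF d] by (simp del: cofactor.simps add: numeral_2_eq_2)
      have "?B 2 \<noteq> 1"
      proof
        assume "?B 2 = 1"
        then have "b ^ (d - 1) - (- a) ^ (d - 1) = 1" using B2 by (simp only:)
        then have "d = 2 \<and> b = - a + 1" by (rule power_gap_eq_one[OF ab d])
        then show False using ne by simp
      qed
      moreover have "?B 2 > 0" using pos[of 1] by (simp only: numeral_2_eq_2 One_nat_def)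
      moreover have "(\<Prod>k=1..<2. \<bar>?B k\<bar>) = \<bar>?B 1\<bar>"
        by (simp del: cofactor.simps add: numeral_2_eq_2)
      ultimately have "(\<Prod>k=1..<2. \<bar>?B k\<bar>) < \<bar>?B 2\<bar>" using one by linarith
      from notin[OF nz this] show ?thesis .
    qed
    show ?thesis
    proof (intro conjI impI)
      show "\<forall>n>2. n \<notin> zsigmondy_set f 0" using tail by blast
      assume "\<not> ((d = 2 \<and> (a + b = 1 \<or> a + b = - 1)) \<or> c = 1 \<or> c = - 1)"
      then have "2 \<notin> zsigmondy_set f 0" using second by blast
      then show "zsigmondy_set f 0 = {}" using tail Z2 by (metis equals0I le_neq_implies_less)
    qed
  qed
qed

end
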